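(* No polynomial-time algorithm can solve the Minimum Cooperative Cut problem with an approximation factor of $o(\sqrt{|\mathcal{V}|/\log|\mathcal{V}|})$, where the submodular cost function is accessible only through a value oracle.
   Context: Minimum Cooperative Cut (MinCoopCut): given a directed graph $\mathcal{G}=(\mathcal{V},\mathcal{E})$ with terminal nodes $s,t\in\mathcal{V}$ and a normalized ($f(\emptyset)=0$), nonnegative, monotone nondecreasing submodular function $f:2^{\mathcal{E}}\to\mathbb{R}_+$, find an $(s,t)$-cut $C\subseteq\mathcal{E}$ minimizing $f(C)$. An $(s,t)$-cut is a set of edges whose removal disconnects all paths from $s$ to $t$. In the value oracle model, the algorithm may query $f(Q)$ for any $Q\subseteq\mathcal{E}$, and its running time counts the number of such queries. *)

theory Defs
  imports Complex_Main
begin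

type_synonym edge = "nat \<times> nat"

definition is_cut :: "nat \<Rightarrow> edge set \<Rightarrow> nat \<Rightarrow> nat \<Rightarrow> edge set \<Rightarrow> bool" where
  "is_cut n E s t C \<longleftrightarrow> C \<subseteq> E \<and> (s, t) \<notin> (E - C)\<^sup>+"

definition submodular_on :: "edge set \<Rightarrow> (edge set \<Rightarrow> real) \<Rightarrow> bool" where
  "submodular_on E f \<longleftrightarrow>
     (\<forall>A B. A \<subseteq> E \<longrightarrow> B \<subseteq> E \<longrightarrow> f (A \<union> B) + f (A \<inter> B) \<le> f A + f B)"

definition valid_instance :: "nat \<Rightarrow> edge set \<Rightarrow> nat \<Rightarrow> nat \<Rightarrow> (edge set \<Rightarrow> real) \<Rightarrow> bool" where
  "valid_instance n E s t f \<longleftrightarrow>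
     E \<subseteq> {0..<n} \<times> {0..<n} \<and> s < n \<and> t < n \<and> s \<noteq> t \<and>
     f {} = 0 \<and> (\<forall>A. A \<subseteq> E \<longrightarrow> 0 \<le> f A) \<and>
     (\<forall>A B. A \<subseteq> B \<longrightarrow> B \<subseteq> E \<longrightarrow> f A \<le> f B) \<and>
     submodular_on E f"

(* Value-oracle algorithms as (adaptive, deterministic) decision trees:
  a node queries f on a set Q and continues depending on the answered value;
  a leaf outputs an edge set. *)

datatype qtree = Leaf "edge set" | Query "edge set" "real \<Rightarrow> qtree"

primrec run_output :: "(edge set \<Rightarrow> real) \<Rightarrow> qtree \<Rightarrow> edge set" where
  "run_output orc (Leaf C) = C"
| "run_output orc (Query Q k) = run_output orc (k (orc Q))"

primrec run_queries :: "(edge set \<Rightarrow> real) \<Rightarrow> qtree \<Rightarrow> nat" where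
  "run_queries orc (Leaf C) = 0"
| "run_queries orc (Query Q k) = Suc (run_queries orc (k (orc Q)))"

definition value_oracle :: "edge set \<Rightarrow> (edge set \<Rightarrow> real) \<Rightarrow> edge set \<Rightarrow> real" where
  "value_oracle E f Q = f (Q \<inter> E)"

end

theory Submission
  imports Defs "HOL-Library.FuncSet"
begin

text \<open>
  The graph consists of \<open>l\<close> disjoint paths with \<open>w\<close> edges each, and a hidden cut \<open>R\<close> takes one edge
  from every path. The cost \<open>min (|Q - R| + min |Q \<inter> R| b) l\<close> gives \<open>R\<close> the value at most \<open>b\<close>, while the
  cost \<open>min |Q| l\<close> gives every cut the value \<open>l\<close>. The two costs differ at \<open>Q\<close> only if \<open>|Q| < 2 l\<close> and \<open>Q\<close>
  contains more than \<open>b\<close> edges of \<open>R\<close>, which for a uniformly random \<open>R\<close> has probability at most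
  \<open>exp (2 l / w) / 2 ^ b\<close>. Run the algorithm on the second cost; a union bound over its queries and its
  output yields an \<open>R\<close> for which it behaves identically on the first cost, so that its ratio is at
  least \<open>l / b\<close>. With \<open>w = 2 ^ p\<close>, \<open>l = p * 2 ^ p\<close> and \<open>b\<close> a large constant multiple of \<open>p\<close>, this is of
  order \<open>sqrt (n / ln n)\<close>.
\<close>

section \<open>Oracle algorithms as decision trees\<close>

primrec run_trace :: "(edge set \<Rightarrow> real) \<Rightarrow> qtree \<Rightarrow> edge set list" where
  "run_trace orc (Leaf C) = []"
| "run_trace orc (Query Q k) = Q # run_trace orc (k (orc Q))"

lemma length_run_trace: "length (run_trace orc T) = run_queries orc T"
  by (induction T) auto

text \<open>Answers alone steer the descent, so agreement on the queries met by \<open>orc\<close>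
  forces the same branch, adaptivity included.\<close>

lemma run_output_cong:
  "(\<And>Q. Q \<in> set (run_trace orc T) \<Longrightarrow> orc' Q = orc Q) \<Longrightarrow> run_output orc' T = run_output orc T"
  by (induction T) auto

section \<open>Truncated cost functions\<close>

lemma submodular_on_add:
  "submodular_on E f \<Longrightarrow> submodular_on E g \<Longrightarrow> submodular_on E (\<lambda>A. f A + g A)"
  unfolding submodular_on_def by (smt (verit, best))

text \<open>If \<open>f A\<close> or \<open>f B\<close> reaches \<open>c\<close>, monotonicity
  suffices; otherwise the right-hand side is untruncated and submodularity of \<open>f\<close>
  applies.\<close>

lemma submodular_on_min_const:
  assumes sub: "submodular_on E f"
    and mono: "\<And>A B. A \<subseteq> B \<Longrightarrow> B \<subseteq> E \<Longrightarrow> f A \<le> f B"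
  shows "submodular_on E (\<lambda>A. min (f A) c)"
  unfolding submodular_on_def
proof (intro allI impI)
  fix A B assume AB: "A \<subseteq> E" "B \<subseteq> E"
  have "f (A \<union> B) + f (A \<inter> B) \<le> f A + f B"
    using sub AB by (simp add: submodular_on_def)
  moreover have "f A \<le> f (A \<union> B)" "f B \<le> f (A \<union> B)" "f (A \<inter> B) \<le> f A" "f (A \<inter> B) \<le> f B"
    using AB by (auto intro!: mono)
  ultimately show "min (f (A \<union> B)) c + min (f (A \<inter> B)) c \<le> min (f A) c + min (f B) c"
    by (simp add: min_def)
qed

lemma submodular_on_card_Int:
  assumes "finite E"
  shows "submodular_on E (\<lambda>A. real (card (A \<inter> S)))"
  unfolding submodular_on_def
proof (intro allI impI)
  fix A B assume "A \<subseteq> E" "B \<subseteq> E"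
  then have "finite (A \<inter> S)" "finite (B \<inter> S)"
    using assms finite_subset by blast+
  from card_Un_Int[OF this] show "real (card ((A \<union> B) \<inter> S)) + real (card ((A \<inter> B) \<inter> S))
      \<le> real (card (A \<inter> S)) + real (card (B \<inter> S))"
    by (simp add: Int_Un_distrib2 Int_assoc Int_left_commute flip: of_nat_add)
qed

text \<open>Taking \<open>R = {}\<close> gives the reference cost \<open>min (card Q) l\<close>, so
  one validity proof serves both costs.\<close>

definition hidden_cost :: "edge set \<Rightarrow> nat \<Rightarrow> nat \<Rightarrow> edge set \<Rightarrow> real" where
  "hidden_cost R b l Q = min (real (card (Q \<inter> - R)) + min (real (card (Q \<inter> R))) (real b)) (real l)"

lemma card_Int_mono:
  "finite E \<Longrightarrow> A \<subseteq> B \<Longrightarrow> B \<subseteq> E \<Longrightarrow> card (A \<inter> S) \<le> card (B \<inter> S)"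
  by (rule card_mono) (auto intro: finite_subset)

lemma hidden_cost_mono:
  assumes "finite E" "A \<subseteq> B" "B \<subseteq> E"
  shows "hidden_cost R b l A \<le> hidden_cost R b l B"
  unfolding hidden_cost_def
  by (intro min.mono add_mono order_refl) (simp_all add: card_Int_mono[OF assms])

lemma submodular_on_hidden_cost:
  assumes "finite E"
  shows "submodular_on E (hidden_cost R b l)"
proof -
  note mono = card_Int_mono[OF assms]
  have "submodular_on E (\<lambda>Q. min (real (card (Q \<inter> R))) (real b))"
    by (rule submodular_on_min_const[OF submodular_on_card_Int[OF assms]]) (simp add: mono)
  then have "submodular_on E (\<lambda>Q. real (card (Q \<inter> - R)) + min (real (card (Q \<inter> R))) (real b))"
    by (intro submodular_on_add submodular_on_card_Int assms)
  then have "submodular_on E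
      (\<lambda>Q. min (real (card (Q \<inter> - R)) + min (real (card (Q \<inter> R))) (real b)) (real l))"
  proof (rule submodular_on_min_const)
    fix A B assume AB: "A \<subseteq> B" "B \<subseteq> E"
    show "real (card (A \<inter> - R)) + min (real (card (A \<inter> R))) (real b)
        \<le> real (card (B \<inter> - R)) + min (real (card (B \<inter> R))) (real b)"
      by (intro min.mono add_mono order_refl) (simp_all add: mono[OF AB])
  qed
  then show ?thesis
    by (simp add: hidden_cost_def[abs_def])
qed

lemma hidden_cost_self_le: "hidden_cost R b l R \<le> real b"
  by (simp add: hidden_cost_def)

lemma hidden_cost_empty_eq: "hidden_cost {} b l Q = min (real (card Q)) (real l)"
  by (simp add: hidden_cost_def)

text \<open>A set of at least \<open>2 * l\<close> edges keeps \<open>l\<close> of them outside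
  \<open>R\<close>, so both costs saturate at \<open>l\<close>. For a smaller set the cap
  \<open>b\<close> is inactive.\<close>

lemma hidden_cost_eq_hidden_cost_empty:
  assumes fin: "finite Q" and R: "finite R" "card R \<le> l"
    and few: "card Q < 2 * l \<Longrightarrow> card (Q \<inter> R) \<le> b"
  shows "hidden_cost R b l Q = hidden_cost {} b l Q"
proof -
  have split: "card Q = card (Q \<inter> - R) + card (Q \<inter> R)"
    using card_Int_Diff[OF fin, of R] by (simp add: Diff_eq)
  have "card (Q \<inter> R) \<le> l"
    using card_mono[of R "Q \<inter> R"] R by auto
  show ?thesis
  proof (cases "card Q < 2 * l")
    case True
    with few have "min (real (card (Q \<inter> R))) (real b) = real (card (Q \<inter> R))"
      by simp
    with split show ?thesis
      by (simp add: hidden_cost_empty_eq hidden_cost_def)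
  next
    case False
    with split \<open>card (Q \<inter> R) \<le> l\<close> have "l \<le> card (Q \<inter> - R)" "l \<le> card Q"
      by linarith+
    then show ?thesis
      by (simp add: hidden_cost_empty_eq hidden_cost_def)
  qed
qed

section \<open>Parallel paths from 0 to 1\<close>

text \<open>All paths share the source 0 and the sink 1; inner vertices are coded by quotient and
  remainder modulo \<open>w\<close>, shifted past these two.\<close>

definition path_vertex :: "nat \<Rightarrow> nat \<Rightarrow> nat \<Rightarrow> nat" where
  "path_vertex w i j = (if j = 0 then 0 else if j = w then 1 else 2 + (i * w + j))"

definition path_edge :: "nat \<Rightarrow> nat \<Rightarrow> nat \<Rightarrow> edge" where
  "path_edge w i j = (path_vertex w i j, path_vertex w i (Suc j))"

definition path_edges :: "nat \<Rightarrow> nat \<Rightarrow> edge set" where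
  "path_edges w l = {path_edge w i j | i j. i < l \<and> j < w}"

definition hidden_cut :: "nat \<Rightarrow> nat \<Rightarrow> (nat \<Rightarrow> nat) \<Rightarrow> edge set" where
  "hidden_cut w l r = (\<lambda>i. path_edge w i (r i)) ` {..<l}"

lemma mult_add_eq_iff:
  fixes w :: nat
  assumes "j < w" "j' < w"
  shows "i * w + j = i' * w + j' \<longleftrightarrow> i = i' \<and> j = j'"
proof
  assume eq: "i * w + j = i' * w + j'"
  have "(i * w + j) div w = i" "(i' * w + j') div w = i'"
    using assms by auto
  with eq show "i = i' \<and> j = j'" by auto
qed auto

lemma path_vertex_eqD:
  assumes "path_vertex w i j = path_vertex w i' j'" "j \<le> w" "j' \<le> w" "0 < w"
  shows "j = j' \<and> (0 < j \<and> j < w \<longrightarrow> i = i')"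
proof (cases "0 < j \<and> j < w \<and> 0 < j' \<and> j' < w")
  case True
  with assms mult_add_eq_iff[of j w j' i i'] show ?thesis
    by (simp add: path_vertex_def)
next
  case False
  with assms show ?thesis
    by (simp add: path_vertex_def split: if_splits)
qed

text \<open>With \<open>2 \<le> w\<close> every edge has an inner endpoint, which determines the
  path; for \<open>w = 1\<close> all paths would be the single edge from 0 to 1.\<close>

lemma path_edge_eqD:
  assumes "path_edge w i j = path_edge w i' j'" "j < w" "j' < w" "2 \<le> w"
  shows "i = i' \<and> j = j'"
proof -
  have "j = j' \<and> (0 < j \<longrightarrow> i = i')"
    using assms path_vertex_eqD[of w i j i' j'] by (auto simp: path_edge_def)
  moreover have "Suc j < w \<longrightarrow> i = i'"
    using assms path_vertex_eqD[of w i "Suc j" i' "Suc j'"] by (auto simp: path_edge_def)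
  ultimately show ?thesis
    using assms by (cases "j = 0") auto
qed

lemma path_edges_image: "path_edges w l = (\<lambda>(i, j). path_edge w i j) ` ({..<l} \<times> {..<w})"
  by (auto simp: path_edges_def)

lemma finite_path_edges: "finite (path_edges w l)"
  by (simp add: path_edges_image)

lemma path_vertex_less:
  assumes "i < l" "j \<le> w"
  shows "path_vertex w i j < 2 + l * w"
proof (cases "j = w")
  case False
  have "Suc i * w \<le> l * w"
    using assms by (intro mult_le_mono1) auto
  with False assms show ?thesis
    by (auto simp: path_vertex_def)
qed (auto simp: path_vertex_def)

lemma path_edges_subset: "path_edges w l \<subseteq> {0..<2 + l * w} \<times> {0..<2 + l * w}"
  using path_vertex_less by (auto simp: path_edges_def path_edge_def)

lemma valid_instance_hidden_cost:
  "valid_instance (2 + l * w) (path_edges w l) 0 1 (hidden_cost R b l)"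
  unfolding valid_instance_def
proof (intro conjI allI impI)
  show "hidden_cost R b l A \<le> hidden_cost R b l B" if "A \<subseteq> B" "B \<subseteq> path_edges w l" for A B
    using that by (intro hidden_cost_mono[OF finite_path_edges])
qed (use path_edges_subset in \<open>auto simp: submodular_on_hidden_cost finite_path_edges hidden_cost_def\<close>)

lemma cut_meets_path:
  assumes cut: "is_cut n (path_edges w l) 0 1 C" and "i < l" "2 \<le> w"
  obtains j where "j < w" "path_edge w i j \<in> C"
proof (rule ccontr)
  assume "\<not> thesis"
  with that have notC: "path_edge w i j \<notin> C" if "j < w" for j
    using that by blast
  have step: "path_edge w i j \<in> path_edges w l - C" if "j < w" for j
    using notC that assms by (auto simp: path_edges_def)
  have "j < w \<Longrightarrow> (0, path_vertex w i (Suc j)) \<in> (path_edges w l - C)\<^sup>+" for j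
  proof (induction j)
    case 0
    then show ?case
      using step[of 0] by (auto simp: path_edge_def path_vertex_def[of w i 0])
  next
    case (Suc j)
    then show ?case
      using step[of "Suc j"] by (auto simp: path_edge_def intro: trancl_into_trancl)
  qed
  from this[of "w - 1"] have "(0, 1) \<in> (path_edges w l - C)\<^sup>+"
    using \<open>2 \<le> w\<close> by (simp add: path_vertex_def)
  with cut show False
    by (simp add: is_cut_def)
qed

text \<open>A cut meets each path, and edges on different paths are distinct. Hence every cut has
  reference cost exactly \<open>l\<close>.\<close>

lemma card_cut_ge:
  assumes cut: "is_cut n (path_edges w l) 0 1 C" and w: "2 \<le> w"
  shows "l \<le> card C"
proof -
  have "\<exists>j. i < l \<longrightarrow> j < w \<and> path_edge w i j \<in> C" for i
    using cut_meets_path[OF cut _ w] by metis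
  then obtain h where h: "\<And>i. i < l \<Longrightarrow> h i < w \<and> path_edge w i (h i) \<in> C"
    by metis
  have "inj_on (\<lambda>i. path_edge w i (h i)) {..<l}"
    using h path_edge_eqD w by (meson inj_onI lessThan_iff)
  moreover have "(\<lambda>i. path_edge w i (h i)) ` {..<l} \<subseteq> C"
    using h by auto
  moreover have "finite C"
    using cut finite_path_edges finite_subset by (auto simp: is_cut_def)
  ultimately show ?thesis
    using card_inj_on_le by fastforce
qed

lemma is_cut_hidden_cut:
  assumes r: "\<And>i. i < l \<Longrightarrow> r i < w"
  shows "is_cut n (path_edges w l) 0 1 (hidden_cut w l r)"
  unfolding is_cut_def
proof (intro conjI notI)
  show "hidden_cut w l r \<subseteq> path_edges w l"
    using r by (auto simp: hidden_cut_def path_edges_def)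
next
  \<comment> \<open>The vertices in front of the hidden edges: closed under the remaining edges, but
    without the sink. Inserting 0 covers \<open>l = 0\<close>.\<close>
  define S where "S = insert 0 {path_vertex w i j | i j. i < l \<and> j \<le> r i}"
  have closed: "v \<in> S" if u: "u \<in> S" and uv: "(u, v) \<in> path_edges w l - hidden_cut w l r" for u v
  proof -
    obtain i j where ij: "i < l" "j < w" "u = path_vertex w i j" "v = path_vertex w i (Suc j)"
      using uv by (auto simp: path_edges_def path_edge_def)
    have "j \<noteq> r i"
      using uv ij by (auto simp: hidden_cut_def path_edge_def)
    moreover have "j \<le> r i"
    \<comment> \<open>The source does not determine its path, but there \<open>j \<le> r i\<close>
      is trivial; any other tail is an inner vertex and determines \<open>i\<close> and
      \<open>j\<close>.\<close>
    proof (cases "j = 0")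
      case False
      then have "u \<noteq> 0"
        using ij by (simp add: path_vertex_def)
      then obtain i' j' where *: "i' < l" "j' \<le> r i'" "u = path_vertex w i' j'"
        using u by (auto simp: S_def)
      then have "j = j' \<and> (0 < j \<and> j < w \<longrightarrow> i = i')"
        using ij r[of i'] by (intro path_vertex_eqD) auto
      with * ij False show ?thesis
        by blast
    qed simp
    ultimately have "Suc j \<le> r i"
      by simp
    with ij show ?thesis
      unfolding S_def by blast
  qed
  assume "(0, 1) \<in> (path_edges w l - hidden_cut w l r)\<^sup>+"
  moreover have "v \<in> S" if "(0, v) \<in> (path_edges w l - hidden_cut w l r)\<^sup>+" for v
    using that
  proof (induction rule: trancl_induct)
    case (base v)
    then show ?case
      by (rule closed[rotated]) (simp add: S_def)
  next
    case (step u v)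
    then show ?case
      using closed by blast
  qed
  ultimately have "1 \<in> S"
    by blast
  then obtain i j where "i < l" "j \<le> r i" "path_vertex w i j = 1"
    by (auto simp: S_def)
  with r[of i] show False
    by (auto simp: path_vertex_def split: if_splits)
qed

section \<open>Counting hidden cuts detected by a query\<close>

text \<open>An exponential moment bound: weighting each \<open>r\<close> with \<open>2\<close> to the number of hits makes the
  sum over all \<open>r\<close> factor over the coordinates.\<close>

lemma card_many_hits_bound:
  fixes P :: "nat \<Rightarrow> nat set"
  assumes P: "\<And>i. i < l \<Longrightarrow> P i \<subseteq> {..<w}" and w: "0 < w"
  shows "real (card {r \<in> {..<l} \<rightarrow>\<^sub>E {..<w}. b \<le> card {i. i < l \<and> r i \<in> P i}}) * 2 ^ b
    \<le> real w ^ l * exp (real (\<Sum>i<l. card (P i)) / real w)"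
proof -
  let ?F = "{..<l} \<rightarrow>\<^sub>E {..<w}"
  let ?hits = "\<lambda>r. card {i. i < l \<and> r i \<in> P i}"
  have fin: "finite ?F"
    by (simp add: finite_PiE)
  have "real (card {r \<in> ?F. b \<le> ?hits r}) * 2 ^ b = (\<Sum>r \<in> {r \<in> ?F. b \<le> ?hits r}. 2 ^ b)"
    by simp
  \<comment> \<open>Markov's inequality in counting form.\<close>
  also have "\<dots> \<le> (\<Sum>r \<in> {r \<in> ?F. b \<le> ?hits r}. 2 ^ ?hits r)"
    by (intro sum_mono) (auto intro: power_increasing)
  also have "\<dots> \<le> (\<Sum>r \<in> ?F. 2 ^ ?hits r)"
    using fin by (intro sum_mono2) auto
  also have "\<dots> = (\<Sum>r \<in> ?F. \<Prod>i<l. if r i \<in> P i then 2 else 1)"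
    by (intro sum.cong refl) (simp add: prod.If_cases Int_def)
  also have "\<dots> = (\<Prod>i<l. \<Sum>j<w. if j \<in> P i then 2 else 1)"
    by (intro prod_sum_PiE[symmetric]) auto
  \<comment> \<open>Each factor is \<open>w + card (P i)\<close>; by
    \<open>1 + x \<le> exp x\<close> only the total size of the \<open>P i\<close> enters the
    bound.\<close>
  also have "\<dots> \<le> (\<Prod>i<l. real w * exp (real (card (P i)) / real w))"
  proof (intro prod_mono conjI)
    fix i assume "i \<in> {..<l}"
    then have Pi: "{..<w} \<inter> {j. j \<in> P i} = P i"
      using P by auto
    have "(\<Sum>j<w. if j \<in> P i then 2 else 1 :: real) = (\<Sum>j<w. 1 + (if j \<in> P i then 1 else 0))"
      by (intro sum.cong) auto
    also have "\<dots> = real w + real (card (P i))"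
      unfolding sum.distrib using Pi by (simp add: sum.If_cases)
    also have "\<dots> = real w * (1 + real (card (P i)) / real w)"
      using w by (simp add: field_simps)
    also have "\<dots> \<le> real w * exp (real (card (P i)) / real w)"
      by (intro mult_left_mono exp_ge_add_one_self) auto
    finally show "(\<Sum>j<w. if j \<in> P i then 2 else 1) \<le> real w * exp (real (card (P i)) / real w)" .
  qed (auto intro!: sum_nonneg)
  also have "\<dots> = real w ^ l * exp (real (\<Sum>i<l. card (P i)) / real w)"
    by (simp add: prod.distrib exp_sum sum_divide_distrib)
  finally show ?thesis .
qed

text \<open>Here \<open>P i\<close> collects the positions of the edges of \<open>Q\<close> on path
  \<open>i\<close>; these sizes sum to at most \<open>card Q\<close>, giving the exponent
  \<open>2 * l / w\<close>.\<close>

lemma card_hidden_cut_bound: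
  assumes Q: "Q \<subseteq> path_edges w l" "card Q \<le> 2 * l" and w: "2 \<le> w"
  shows "real (card {r \<in> {..<l} \<rightarrow>\<^sub>E {..<w}. b \<le> card (Q \<inter> hidden_cut w l r)}) * 2 ^ b
    \<le> real w ^ l * exp (2 * real l / real w)"
proof -
  define P where "P i = {j. j < w \<and> path_edge w i j \<in> Q}" for i
  have fin: "finite Q"
    using Q finite_path_edges finite_subset by blast
  have "(\<Sum>i<l. card (P i)) = card (SIGMA i:{..<l}. P i)"
    by (subst card_SigmaI) (auto simp: P_def)
  also have "\<dots> \<le> card Q"
    using fin path_edge_eqD[OF _ _ _ w]
    by (intro card_inj_on_le[where f = "\<lambda>(i, j). path_edge w i j"]) (auto simp: P_def inj_on_def)
  finally have sum_le: "real (\<Sum>i<l. card (P i)) \<le> 2 * real l"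
    using Q by linarith
  have hits: "card (Q \<inter> hidden_cut w l r) = card {i. i < l \<and> r i \<in> P i}"
    if "r \<in> {..<l} \<rightarrow>\<^sub>E {..<w}" for r
  proof -
    have r: "r i < w" if "i < l" for i
      using that \<open>r \<in> _\<close> by auto
    have "Q \<inter> hidden_cut w l r = (\<lambda>i. path_edge w i (r i)) ` {i. i < l \<and> r i \<in> P i}"
      using r by (auto simp: hidden_cut_def P_def)
    moreover have "inj_on (\<lambda>i. path_edge w i (r i)) {i. i < l \<and> r i \<in> P i}"
      using r path_edge_eqD[OF _ _ _ w] by (auto simp: inj_on_def)
    ultimately show ?thesis
      by (simp add: card_image)
  qed
  have "real (card {r \<in> {..<l} \<rightarrow>\<^sub>E {..<w}. b \<le> card (Q \<inter> hidden_cut w l r)}) * 2 ^ b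
      = real (card {r \<in> {..<l} \<rightarrow>\<^sub>E {..<w}. b \<le> card {i. i < l \<and> r i \<in> P i}}) * 2 ^ b"
    using hits by (metis (mono_tags, lifting))
  also have "\<dots> \<le> real w ^ l * exp (real (\<Sum>i<l. card (P i)) / real w)"
    using w by (intro card_many_hits_bound) (auto simp: P_def)
  also have "\<dots> \<le> real w ^ l * exp (2 * real l / real w)"
    using sum_le by (intro mult_left_mono) (auto intro!: divide_right_mono simp del: of_nat_sum)
  finally show ?thesis .
qed

text \<open>The union bound, by counting: the choices \<open>r\<close> detected by some member of
  \<open>\<Q>\<close> number fewer than all \<open>w ^ l\<close> choices.\<close>

lemma exists_undetected_hidden_cut:
  assumes fin: "finite \<Q>" and w: "2 \<le> w"
    and \<Q>: "\<And>Q. Q \<in> \<Q> \<Longrightarrow> Q \<subseteq> path_edges w l"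
    and few: "real (card \<Q>) * exp (2 * real l / real w) < 2 ^ b"
  obtains r where "\<And>i. i < l \<Longrightarrow> r i < w"
    "\<And>Q. Q \<in> \<Q> \<Longrightarrow> hidden_cost (hidden_cut w l r) b l Q = hidden_cost {} b l Q"
proof -
  let ?F = "{..<l} \<rightarrow>\<^sub>E {..<w}"
  define bad where "bad Q = {r \<in> ?F. b \<le> card (Q \<inter> hidden_cut w l r)}" for Q
  \<comment> \<open>Larger sets saturate both costs and detect nothing, so the union runs over these
    only.\<close>
  define \<S> where "\<S> = {Q \<in> \<Q>. card Q \<le> 2 * l}"
  have finF: "finite ?F" by (simp add: finite_PiE)
  have "real (card (\<Union>Q\<in>\<S>. bad Q)) * 2 ^ b \<le> (\<Sum>Q\<in>\<S>. real (card (bad Q))) * 2 ^ b"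
    using card_UN_le[of \<S> bad] fin
    by (intro mult_right_mono) (simp_all add: \<S>_def flip: of_nat_sum)
  also have "\<dots> = (\<Sum>Q\<in>\<S>. real (card (bad Q)) * 2 ^ b)"
    by (rule sum_distrib_right)
  also have "\<dots> \<le> (\<Sum>Q\<in>\<S>. real w ^ l * exp (2 * real l / real w))"
    unfolding bad_def using \<Q> w by (intro sum_mono card_hidden_cut_bound) (auto simp: \<S>_def)
  also have "\<dots> \<le> real w ^ l * (real (card \<Q>) * exp (2 * real l / real w))"
    using card_mono[OF fin, of \<S>]
    by (simp add: \<S>_def mult.left_commute[of "real w ^ l"] mult_right_mono)
  also have "\<dots> < real w ^ l * 2 ^ b"
    using few w by (intro mult_strict_left_mono) auto
  finally have "card (\<Union>Q\<in>\<S>. bad Q) < card ?F"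
    by (simp add: card_funcsetE flip: of_nat_power)
  then obtain r where r: "r \<in> ?F" "r \<notin> (\<Union>Q\<in>\<S>. bad Q)"
    using card_mono[of "\<Union>Q\<in>\<S>. bad Q" ?F] finF
    by (metis (no_types, lifting) UN_iff bad_def finite_subset leD mem_Collect_eq subsetI fin)
  have "hidden_cost (hidden_cut w l r) b l Q = hidden_cost {} b l Q" if "Q \<in> \<Q>" for Q
  proof (rule hidden_cost_eq_hidden_cost_empty)
    show "finite Q"
      using \<Q>[OF that] finite_path_edges finite_subset by blast
    show "card (hidden_cut w l r) \<le> l"
      unfolding hidden_cut_def using card_image_le[of "{..<l}"] by fastforce
    show "card (Q \<inter> hidden_cut w l r) \<le> b" if "card Q < 2 * l"
      using r that \<open>Q \<in> \<Q>\<close> by (force simp: \<S>_def bad_def)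
  qed (simp add: hidden_cut_def)
  moreover have "r i < w" if "i < l" for i
    using r that by auto
  ultimately show thesis
    using that by blast
qed

lemma hard_instance:
  assumes w: "2 \<le> w" and l: "0 < l"
    and queries: "run_queries (value_oracle (path_edges w l) (hidden_cost {} b l)) T \<le> m"
    and few: "(real m + 1) * exp (2 * real l / real w) < 2 ^ b"
    and factor: "a * real b < real l"
  shows "\<exists>f. valid_instance (2 + l * w) (path_edges w l) 0 1 f \<and>
    (let C = run_output (value_oracle (path_edges w l) f) T in
      \<not> (is_cut n (path_edges w l) 0 1 C \<and>
         (\<forall>C'. is_cut n (path_edges w l) 0 1 C' \<longrightarrow> f C \<le> a * f C')))"
proof -
  let ?E = "path_edges w l"
  let ?orc = "value_oracle ?E (hidden_cost {} b l)"
  define C where "C = run_output ?orc T"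
  \<comment> \<open>The output joins the queries, so that its cost is also unchanged; this is the
    \<open>+ 1\<close> in \<open>few\<close>.\<close>
  define \<Q> where "\<Q> = (\<lambda>Q. Q \<inter> ?E) ` insert C (set (run_trace ?orc T))"
  have "card \<Q> \<le> card (insert C (set (run_trace ?orc T)))"
    unfolding \<Q>_def by (intro card_image_le) auto
  also have "\<dots> \<le> Suc (card (set (run_trace ?orc T)))"
    by (rule card_insert_le_m1) auto
  also have "\<dots> \<le> Suc m"
    using card_length[of "run_trace ?orc T"] queries by (simp add: length_run_trace)
  finally have "real (card \<Q>) \<le> real m + 1"
    by simp
  then have "real (card \<Q>) * exp (2 * real l / real w) < 2 ^ b"
    using few by (meson exp_ge_zero le_less_trans mult_right_mono)
  then obtain r where r: "\<And>i. i < l \<Longrightarrow> r i < w"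
    and same: "\<And>Q. Q \<in> \<Q> \<Longrightarrow> hidden_cost (hidden_cut w l r) b l Q = hidden_cost {} b l Q"
    using exists_undetected_hidden_cut[of \<Q> w l b] w by (auto simp: \<Q>_def)
  let ?R = "hidden_cut w l r"
  let ?f = "hidden_cost ?R b l"
  have out: "run_output (value_oracle ?E ?f) T = C"
    unfolding C_def by (rule run_output_cong) (auto simp: value_oracle_def intro!: same simp: \<Q>_def)
  have "\<not> ?f C \<le> a * ?f ?R" if cut: "is_cut n ?E 0 1 C"
  proof -
    have "C \<inter> ?E = C"
      using cut by (auto simp: is_cut_def)
    then have "?f C = hidden_cost {} b l C"
      using same[of "C \<inter> ?E"] by (auto simp: \<Q>_def)
    also have "\<dots> = real l"
      using card_cut_ge[OF cut w] by (simp add: hidden_cost_empty_eq)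
    finally have fC: "?f C = real l" .
    have "a * ?f ?R < real l"
    \<comment> \<open>The bound \<open>b\<close> on the cost of \<open>?R\<close> can be scaled by
      \<open>a\<close> only for nonnegative \<open>a\<close>.\<close>
    proof (cases "a \<le> 0")
      case True
      then have "a * ?f ?R \<le> 0"
        by (intro mult_nonpos_nonneg) (auto simp: hidden_cost_def)
      with l show ?thesis by linarith
    next
      case False
      then have "a * ?f ?R \<le> a * real b"
        by (intro mult_left_mono hidden_cost_self_le) auto
      with factor show ?thesis by linarith
    qed
    with fC show ?thesis by simp
  qed
  moreover have "is_cut n ?E 0 1 ?R"
    using r by (rule is_cut_hidden_cut)
  ultimately show ?thesis
    using valid_instance_hidden_cost[of l w ?R b] out by (auto simp: Let_def)
qed

section \<open>Choice of parameters\<close>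

text \<open>Since \<open>p < 2 ^ p\<close>, the size is polynomial in \<open>2 ^ p\<close>, so
  \<open>n ^ k\<close> is at most 2 to an exponent linear in \<open>p\<close>.\<close>

lemma size_le:
  fixes p :: nat
  assumes "1 \<le> p"
  shows "2 + (p * 2 ^ p) * 2 ^ p \<le> (16::nat) ^ p"
proof -
  have "(2::nat) \<le> 2 ^ p"
    using power_increasing[of 1 p "2::nat"] assms by simp
  moreover have "(8::nat) \<le> 8 ^ p"
    using power_increasing[of 1 p "8::nat"] assms by simp
  then have "2 + (8::nat) ^ p \<le> 2 * 8 ^ p"
    by simp
  moreover have "(p * 2 ^ p) * 2 ^ p \<le> (2 ^ p * 2 ^ p) * (2::nat) ^ p"
    by (intro mult_le_mono) (auto simp: less_imp_le)
  then have "(p * 2 ^ p) * 2 ^ p \<le> (8::nat) ^ p"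
    by (simp flip: power_mult_distrib)
  moreover have "(2::nat) ^ p * 8 ^ p = 16 ^ p"
    by (simp flip: power_mult_distrib)
  ultimately show ?thesis
    by (smt (verit, best) add_le_mono le_refl le_trans mult_le_mono1)
qed

text \<open>The exponent adds \<open>4 * p\<close> from \<open>exp 2 \<le> 9 \<le> 16\<close>,
  \<open>4 * k * p\<close> from \<open>n ^ k\<close>, \<open>(2 * c + 1) * p\<close> from the
  coefficients, and a final \<open>p\<close> for strictness.\<close>

lemma query_bound:
  fixes c k p :: nat
  assumes p: "1 \<le> p" and n: "n \<le> 16 ^ p"
  shows "(real (c * n ^ k + c) + 1) * exp (2 * real p) < 2 ^ ((2 * c + 4 * k + 6) * p)"
proof -
  have "exp (2::real) = exp 1 * exp 1"
    by (simp flip: exp_add)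
  also have "\<dots> \<le> 3 * 3"
    by (intro mult_mono exp_le) auto
  finally have "exp (2::real) ^ p \<le> (2 ^ 4) ^ p"
    by (intro power_mono) auto
  also have "\<dots> = 2 ^ (4 * p)"
    by (rule power_mult[symmetric])
  finally have e: "exp (2 * real p) \<le> 2 ^ (4 * p)"
    by (simp add: mult.commute flip: exp_of_nat_mult)
  have nk: "n ^ k \<le> 2 ^ (4 * k * p)"
  proof -
    have "n ^ k \<le> (16 ^ p) ^ k"
      using n by (intro power_mono) auto
    also have "\<dots> = (2 ^ 4) ^ (p * k)"
      by (simp add: power_mult)
    also have "\<dots> = 2 ^ (4 * k * p)"
      unfolding power_mult[symmetric] by (simp add: ac_simps)
    finally show ?thesis .
  qed
  have "c * n ^ k + c + 1 \<le> (2 * c + 1) * 2 ^ (4 * k * p)"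
  proof -
    have "c * n ^ k \<le> c * 2 ^ (4 * k * p)"
      using nk by (rule mult_le_mono2)
    moreover have "c * 1 \<le> c * 2 ^ (4 * k * p)"
      by (intro mult_le_mono2) simp
    moreover have "(1::nat) \<le> 2 ^ (4 * k * p)"
      by simp
    ultimately show ?thesis
      unfolding add_mult_distrib by linarith
  qed
  also have "\<dots> \<le> 2 ^ ((2 * c + 1) * p) * 2 ^ (4 * k * p)"
  proof (intro mult_le_mono1)
    have "(2 * c + 1) * 1 \<le> (2 * c + 1) * p"
      using p by (rule mult_le_mono2)
    also have "\<dots> \<le> 2 ^ ((2 * c + 1) * p)"
      using less_exp less_imp_le by blast
    finally show "2 * c + 1 \<le> 2 ^ ((2 * c + 1) * p)"
      by simp
  qed
  also have "\<dots> = 2 ^ ((2 * c + 4 * k + 1) * p)"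
    by (simp add: algebra_simps power_add)
  finally have m: "c * n ^ k + c + 1 \<le> 2 ^ ((2 * c + 4 * k + 1) * p)" .
  then have "real (c * n ^ k + c + 1) \<le> 2 ^ ((2 * c + 4 * k + 1) * p)"
    by (metis of_nat_le_iff of_nat_numeral of_nat_power)
  then have "(real (c * n ^ k + c) + 1) * exp (2 * real p) \<le> 2 ^ ((2 * c + 4 * k + 1) * p) * 2 ^ (4 * p)"
    using e by (intro mult_mono) auto
  also have "\<dots> = 2 ^ ((2 * c + 4 * k + 5) * p)"
    by (simp add: algebra_simps flip: power_add)
  also have "\<dots> < 2 ^ ((2 * c + 4 * k + 6) * p)"
    using p by (intro power_strict_increasing) auto
  finally show ?thesis .
qed

text \<open>From \<open>n \<ge> 4 ^ p\<close> and \<open>ln 4 \<ge> 1\<close> follows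
  \<open>ln n \<ge> p\<close>, which cancels the factor \<open>p\<close> in
  \<open>n \<le> 4 * 4 ^ p * p\<close>.\<close>

lemma sqrt_size_over_ln_bounds:
  fixes p :: nat
  defines "n \<equiv> 2 + (p * 2 ^ p) * 2 ^ p"
  assumes p: "1 \<le> p"
  shows "0 < sqrt (real n / ln (real n))" "sqrt (real n / ln (real n)) \<le> 2 * 2 ^ p"
proof -
  have n: "real n = 2 + real p * 4 ^ p"
    by (simp add: n_def mult.assoc flip: power_mult_distrib)
  have pp: "1 * 4 ^ 1 \<le> real p * 4 ^ p"
    using p by (intro mult_mono power_increasing) auto
  have "1 * 4 ^ p \<le> real p * 4 ^ p"
    using p by (intro mult_right_mono) auto
  then have "4 ^ p \<le> real n"
    using n by linarith
  then have "ln (4 ^ p) \<le> ln (real n)"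
    by (intro ln_mono) auto
  moreover have "1 \<le> ln (4::real)"
    using exp_le by (subst ln_ge_iff) auto
  then have "real p * 1 \<le> real p * ln 4"
    by (intro mult_left_mono) auto
  ultimately have ln: "real p \<le> ln (real n)"
    by (simp add: ln_realpow)
  then have pos: "0 < ln (real n)"
    using p by simp
  then show "0 < sqrt (real n / ln (real n))"
    by (simp add: n_def add_pos_nonneg)
  have "real n \<le> 4 * 4 ^ p * real p"
    using n pp by (simp add: mult.commute)
  also have "\<dots> \<le> 4 * 4 ^ p * ln (real n)"
    using ln by (intro mult_left_mono) auto
  finally have "real n / ln (real n) \<le> 4 * 4 ^ p"
    using pos by (simp add: divide_le_eq)
  also have "\<dots> = (2 * 2 ^ p)\<^sup>2"
    by (simp add: power2_eq_square flip: power_mult_distrib)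
  finally show "sqrt (real n / ln (real n)) \<le> 2 * 2 ^ p"
    by (intro real_le_lsqrt) auto
qed

theorem theorem1:
  fixes alg :: "nat \<Rightarrow> edge set \<Rightarrow> nat \<Rightarrow> nat \<Rightarrow> qtree"
    and \<alpha> :: "nat \<Rightarrow> real"
    and c k :: nat
  assumes poly_queries: "\<And>n E s t f. valid_instance n E s t f \<Longrightarrow>
             run_queries (value_oracle E f) (alg n E s t) \<le> c * n ^ k + c"
    and small_factor: "(\<lambda>n. \<alpha> n / sqrt (real n / ln (real n))) \<longlonglongrightarrow> 0"
  shows "\<exists>n E s t f. valid_instance n E s t f \<and>
           (let C = run_output (value_oracle E f) (alg n E s t) in
             \<not> (is_cut n E s t C \<and> (\<forall>C'. is_cut n E s t C' \<longrightarrow> f C \<le> \<alpha> n * f C')))"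
proof -
  define A where "A = 2 * c + 4 * k + 6"
  define N where "N p = 2 + (p * 2 ^ p) * 2 ^ p" for p :: nat
  \<comment> \<open>Combined with the upper bound \<open>2 * 2 ^ p\<close> on the square root, this
    threshold gives \<open>\<alpha> n * b < l / 2\<close>.\<close>
  have "0 < 1 / (4 * real A)"
    by (simp add: A_def)
  then have "\<forall>\<^sub>F n in sequentially. \<alpha> n / sqrt (real n / ln (real n)) < 1 / (4 * real A)"
    using small_factor order_tendstoD(2) by blast
  then obtain p0 where p0: "\<And>n. p0 \<le> n \<Longrightarrow> \<alpha> n / sqrt (real n / ln (real n)) < 1 / (4 * real A)"
    by (auto simp: eventually_sequentially)
  \<comment> \<open>The successor ensures \<open>1 \<le> p\<close> along with
    \<open>p0 \<le> N p\<close>.\<close>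
  define p where "p = Suc p0"
  \<comment> \<open>Since \<open>l / w = p\<close>, the factor \<open>exp (2 * l / w)\<close> is
    absorbed by \<open>2 ^ b\<close> with \<open>b\<close> linear in \<open>p\<close>, while
    \<open>l / b = 2 ^ p / A\<close>.\<close>
  let ?n = "N p" and ?w = "2 ^ p :: nat" and ?l = "p * 2 ^ p" and ?b = "A * p"
  let ?E = "path_edges ?w ?l"
  have p: "1 \<le> p"
    by (simp add: p_def)
  have w: "2 \<le> ?w"
    using power_increasing[of 1 p "2::nat"] p by simp
  have "p * 1 * 1 \<le> ?l * ?w"
    by (intro mult_le_mono) auto
  then have "p0 \<le> ?n"
    by (simp add: N_def p_def)
  then have "\<alpha> ?n / sqrt (real ?n / ln (real ?n)) < 1 / (4 * real A)"
    by (rule p0)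
  then have "\<alpha> ?n < 1 / (4 * real A) * sqrt (real ?n / ln (real ?n))"
    using sqrt_size_over_ln_bounds(1)[OF p] by (simp add: N_def pos_divide_less_eq)
  also have "\<dots> \<le> 1 / (4 * real A) * (2 * 2 ^ p)"
    using sqrt_size_over_ln_bounds(2)[OF p] unfolding N_def by (intro mult_left_mono) auto
  finally have "\<alpha> ?n * real ?b < 1 / (4 * real A) * (2 * 2 ^ p) * real ?b"
    using p by (intro mult_strict_right_mono) (auto simp: A_def)
  also have "\<dots> = real ?l / 2"
    by (simp add: A_def field_simps)
  also have "\<dots> \<le> real ?l"
    by simp
  finally have factor: "\<alpha> ?n * real ?b < real ?l" .
  have queries: "run_queries (value_oracle ?E (hidden_cost {} ?b ?l)) (alg ?n ?E 0 1) \<le> c * ?n ^ k + c"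
    unfolding N_def by (rule poly_queries[OF valid_instance_hidden_cost])
  have few: "(real (c * ?n ^ k + c) + 1) * exp (2 * real ?l / real ?w) < 2 ^ ?b"
    using query_bound[OF p size_le[OF p], of c k] by (simp add: N_def A_def)
  have "0 < ?l"
    using p by simp
  from hard_instance[OF w this queries few factor] show ?thesis
    unfolding N_def by blast
qed

end
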